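(* Let $\mathcal{H}$ be an infinite-dimensional Hilbert space and let $G$ be a subgroup of the unitary group $\mathrm{U}(\mathcal{H})$. Assume that there is an infinite set of projections $\mathcal{P}\subseteq \mathrm{Proj}(\mathrm{B}(\mathcal{H}))$ such that the following conditions are satisfied: (A) There exists a sequence $(p_n)_{n\in\mathbb{N}}$ of mutually orthogonal nonzero projections in $\mathcal{P}$ summing to the identity such that for each sequence $(g_n)_{n\in\mathbb{N}}\subseteq G$ with $g_np_n=p_ng_n$ for all $n$ one has $\bigoplus_{n\in\mathbb{N}}g_{n}p_n \in G$. (B) For each nonzero $p\in \mathcal{P}$ there are $n\in\mathbb{N}$, some nonzero subprojection $q\leq p$ with $q\in\mathcal{P}$, and $g\in G(p)$ such that $G(q)\subseteq (g^{G(p)}\cup g^{-G(p)})^n$. (C) For each nonzero projection $p\in \mathcal{P}$ there are $m\in\mathbb{N}$ and some finite set $F\subseteq G$ such that $G=(G(p)\cup F)^m$. Then $G$ has strong uncountable cofinality. Moreover, if there are fixed exponents $n$ in (B) and $m$ in (C) (i.e. $n$ and $m$ can be chosen independently of $p$), then $G$ has $3nm$-strong uncountable cofinality.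
   Context: $\mathcal{H}$ is not assumed separable. $\mathrm{B}(\mathcal{H})$ is the algebra of bounded operators on $\mathcal{H}$, $\mathrm{U}(\mathcal{H})$ its unitary group and $\mathrm{Proj}(\mathrm{B}(\mathcal{H}))$ its set of (orthogonal) projections; $q\leq p$ means that $q$ is a subprojection of $p$. For $g\in G$ let $p_g$ be the projection onto $\{\xi\in\mathcal{H}\mid g\xi=\xi\}$ and $\mathrm{supp}\, g=1-p_g$. For a projection $p$, $G(p)=\{g\in G\mid \mathrm{supp}\, g\leq p\}$, a subgroup of $G$. For a group $H$ and $g\in H$, $g^{H}=\{hgh^{-1}\mid h\in H\}$ and $g^{-H}=(g^{-1})^{H}$. For a subset $W$ of a group, $W^k=\{w_1\cdots w_k\mid w_i\in W\}$. A group $G$ has strong uncountable cofinality if for every increasing chain of subsets $W_1\subseteq W_2\subseteq\ldots\subseteq G$ with $G=\bigcup_{n\in\mathbb{N}}W_n$ there exist $k,n\in\mathbb{N}$ such that $G=W_n^k$; if $k$ can be chosen independently of the sequence $(W_n)_{n\in\mathbb{N}}$, $G$ has $k$-strong uncountable cofinality. *)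

theory Defs
  imports "HOL-Analysis.Analysis" "HOL-Algebra.Coset"
begin

text \<open>
  Hilbert spaces are complex and of arbitrary (not necessarily countable) dimension; the inner
  product is linear in its first argument.
\<close>

class complex_inner = real_normed_vector +
  fixes scaleC :: "complex \<Rightarrow> 'a \<Rightarrow> 'a" (infixr "*\<^sub>C" 75)
    and cinner :: "'a \<Rightarrow> 'a \<Rightarrow> complex"
  assumes scaleC_add_right: "c *\<^sub>C (x + y) = c *\<^sub>C x + c *\<^sub>C y"
    and scaleC_add_left: "(c + d) *\<^sub>C x = c *\<^sub>C x + d *\<^sub>C x"
    and scaleC_scaleC: "c *\<^sub>C (d *\<^sub>C x) = (c * d) *\<^sub>C x"
    and scaleC_one: "1 *\<^sub>C x = x"
    and scaleR_scaleC: "r *\<^sub>R x = complex_of_real r *\<^sub>C x"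
    and cinner_commute: "cinner x y = cnj (cinner y x)"
    and cinner_add_left: "cinner (x + y) z = cinner x z + cinner y z"
    and cinner_scaleC_left: "cinner (c *\<^sub>C x) y = c * cinner x y"
    and norm_cinner: "cinner x x = complex_of_real ((norm x)\<^sup>2)"

class chilbert_space = complex_inner + banach

lemma vector_space_scaleC: "vector_space (scaleC :: complex \<Rightarrow> 'a::complex_inner \<Rightarrow> 'a)"
  by unfold_locales (simp_all add: scaleC_add_right scaleC_add_left scaleC_scaleC scaleC_one)

definition infinite_cdim :: "'a::complex_inner itself \<Rightarrow> bool" where
  "infinite_cdim _ \<longleftrightarrow> \<not> (\<exists>B :: 'a set. finite B \<and> module.span scaleC B = UNIV)"

text \<open>Operators are plain functions; \<open>BH\<close> is the set of bounded complex-linear ones.\<close>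

definition BH :: "('a::complex_inner \<Rightarrow> 'a) set" where
  "BH = {T. bounded_linear T \<and> (\<forall>c x. T (c *\<^sub>C x) = c *\<^sub>C T x)}"

definition is_cadjoint :: "('a::complex_inner \<Rightarrow> 'a) \<Rightarrow> ('a \<Rightarrow> 'a) \<Rightarrow> bool" where
  "is_cadjoint S T \<longleftrightarrow> (\<forall>x y. cinner (T x) y = cinner x (S y))"

definition unitary :: "('a::complex_inner \<Rightarrow> 'a) \<Rightarrow> bool" where
  "unitary u \<longleftrightarrow> u \<in> BH \<and> (\<exists>v\<in>BH. is_cadjoint v u \<and> v \<circ> u = id \<and> u \<circ> v = id)"

definition unitary_group :: "('a::complex_inner \<Rightarrow> 'a) monoid" ("\<U>") where
  "\<U> = \<lparr>carrier = {u. unitary u}, mult = (\<circ>), one = id\<rparr>"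

lemma group_unitary_group: "group \<U>"
proof (rule groupI)
  fix x y :: "'a \<Rightarrow> 'a"
  assume "x \<in> carrier \<U>" "y \<in> carrier \<U>"
  then obtain v w where *: "x \<in> BH" "y \<in> BH" "v \<in> BH" "w \<in> BH" "is_cadjoint v x" "is_cadjoint w y"
    "v \<circ> x = id" "x \<circ> v = id" "w \<circ> y = id" "y \<circ> w = id"
    by (auto simp: unitary_group_def unitary_def)
  have "x \<circ> y \<in> BH" "w \<circ> v \<in> BH"
    using * by (auto simp: BH_def o_def intro: bounded_linear_compose)
  moreover have "is_cadjoint (w \<circ> v) (x \<circ> y)"
    using * by (auto simp: is_cadjoint_def)
  moreover have "(w \<circ> v) \<circ> (x \<circ> y) = id" "(x \<circ> y) \<circ> (w \<circ> v) = id"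
    using * by (metis comp_assoc comp_id)+
  ultimately show "x \<otimes>\<^bsub>\<U>\<^esub> y \<in> carrier \<U>"
    by (auto simp: unitary_group_def unitary_def)
next
  show "\<one>\<^bsub>\<U>\<^esub> \<in> carrier (\<U> :: ('a \<Rightarrow> 'a) monoid)"
    by (auto simp: unitary_group_def unitary_def BH_def is_cadjoint_def id_def bounded_linear_ident
        intro!: exI[of _ "\<lambda>x. x"])
next
  fix x :: "'a \<Rightarrow> 'a" assume "x \<in> carrier \<U>"
  then obtain v where v: "x \<in> BH" "v \<in> BH" "is_cadjoint v x" "v \<circ> x = id" "x \<circ> v = id"
    by (auto simp: unitary_group_def unitary_def)
  have "is_cadjoint x v"
    using v(3) unfolding is_cadjoint_def by (metis cinner_commute)
  then show "\<exists>y\<in>carrier \<U>. y \<otimes>\<^bsub>\<U>\<^esub> x = \<one>\<^bsub>\<U>\<^esub>"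
    using v by (auto simp: unitary_group_def unitary_def intro!: exI[of _ v])
qed (auto simp: unitary_group_def comp_assoc)

definition is_projection :: "('a::complex_inner \<Rightarrow> 'a) \<Rightarrow> bool" where
  "is_projection p \<longleftrightarrow> p \<in> BH \<and> p \<circ> p = p \<and> is_cadjoint p p"

definition zero_op :: "'a::complex_inner \<Rightarrow> 'a" where
  "zero_op = (\<lambda>_. 0)"

definition subprojection :: "('a::complex_inner \<Rightarrow> 'a) \<Rightarrow> ('a \<Rightarrow> 'a) \<Rightarrow> bool" (infix "\<le>\<^sub>p" 50) where
  "q \<le>\<^sub>p p \<longleftrightarrow> is_projection q \<and> is_projection p \<and> range q \<subseteq> range p"

text \<open>
  Well defined whenever \<open>M\<close> is a closed complex subspace of a Hilbert space, in particular for
  the fixed-point space of a bounded operator.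
\<close>

definition proj_onto :: "'a::complex_inner set \<Rightarrow> 'a \<Rightarrow> 'a" where
  "proj_onto M = (THE p. is_projection p \<and> range p = M)"

definition supp :: "('a::complex_inner \<Rightarrow> 'a) \<Rightarrow> 'a \<Rightarrow> 'a" where
  "supp g = (\<lambda>x. x - proj_onto {\<xi>. g \<xi> = \<xi>} x)"

definition supp_subgroup :: "('a::complex_inner \<Rightarrow> 'a) set \<Rightarrow> ('a \<Rightarrow> 'a) \<Rightarrow> ('a \<Rightarrow> 'a) set" where
  "supp_subgroup G p = {g \<in> G. supp g \<le>\<^sub>p p}"

text \<open>Pointwise norm convergence, i.e. convergence of the series in the strong operator topology.\<close>

definition sot_sums :: "(nat \<Rightarrow> 'a::complex_inner \<Rightarrow> 'a) \<Rightarrow> ('a \<Rightarrow> 'a) \<Rightarrow> bool" where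
  "sot_sums T S \<longleftrightarrow> (\<forall>x. (\<lambda>n. T n x) sums S x)"

definition conj_class :: "('g, 'm) monoid_scheme \<Rightarrow> 'g set \<Rightarrow> 'g \<Rightarrow> 'g set" where
  "conj_class K H g = {h \<otimes>\<^bsub>K\<^esub> g \<otimes>\<^bsub>K\<^esub> inv\<^bsub>K\<^esub> h | h. h \<in> H}"

definition set_power :: "('g, 'm) monoid_scheme \<Rightarrow> 'g set \<Rightarrow> nat \<Rightarrow> 'g set" where
  "set_power K W k = {foldr (\<otimes>\<^bsub>K\<^esub>) ws \<one>\<^bsub>K\<^esub> | ws. length ws = k \<and> set ws \<subseteq> W}"

text \<open>
  Exponents range over the positive integers. For exponents that are merely asserted to exist this
  makes no difference; a prescribed exponent \<open>0\<close> would force the group to be trivial.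
\<close>

definition exhausting_chain :: "('g, 'm) monoid_scheme \<Rightarrow> (nat \<Rightarrow> 'g set) \<Rightarrow> bool" where
  "exhausting_chain K W \<longleftrightarrow> incseq W \<and> (\<Union>n. W n) = carrier K"

definition strong_uncountable_cofinality :: "('g, 'm) monoid_scheme \<Rightarrow> bool" where
  "strong_uncountable_cofinality K \<longleftrightarrow>
    (\<forall>W. exhausting_chain K W \<longrightarrow> (\<exists>k\<ge>1. \<exists>n. carrier K = set_power K (W n) k))"

definition k_strong_uncountable_cofinality :: "nat \<Rightarrow> ('g, 'm) monoid_scheme \<Rightarrow> bool" where
  "k_strong_uncountable_cofinality k K \<longleftrightarrow>
    (\<forall>W. exhausting_chain K W \<longrightarrow> (\<exists>n. carrier K = set_power K (W n) k))"

definition condition_A :: "('a::complex_inner \<Rightarrow> 'a) set \<Rightarrow> ('a \<Rightarrow> 'a) set \<Rightarrow> bool" where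
  "condition_A G P \<longleftrightarrow>
    (\<exists>p :: nat \<Rightarrow> 'a \<Rightarrow> 'a.
      (\<forall>n. p n \<in> P \<and> p n \<noteq> zero_op) \<and>
      (\<forall>i j. i \<noteq> j \<longrightarrow> p i \<circ> p j = zero_op) \<and>
      sot_sums p id \<and>
      (\<forall>g. (\<forall>n. g n \<in> G \<and> g n \<circ> p n = p n \<circ> g n) \<longrightarrow>
        (\<exists>u\<in>G. sot_sums (\<lambda>n. g n \<circ> p n) u)))"

definition condition_B :: "('a::complex_inner \<Rightarrow> 'a) set \<Rightarrow> ('a \<Rightarrow> 'a) set \<Rightarrow> ('a \<Rightarrow> 'a) \<Rightarrow> nat \<Rightarrow> bool" where
  "condition_B G P p n \<longleftrightarrow>
    (\<exists>q\<in>P. q \<noteq> zero_op \<and> q \<le>\<^sub>p p \<and>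
      (\<exists>g\<in>supp_subgroup G p. supp_subgroup G q \<subseteq>
        set_power \<U> (conj_class \<U> (supp_subgroup G p) g \<union>
                       conj_class \<U> (supp_subgroup G p) (inv\<^bsub>\<U>\<^esub> g)) n))"

definition condition_C :: "('a::complex_inner \<Rightarrow> 'a) set \<Rightarrow> ('a \<Rightarrow> 'a) \<Rightarrow> nat \<Rightarrow> bool" where
  "condition_C G p m \<longleftrightarrow>
    (\<exists>F. finite F \<and> F \<subseteq> G \<and> G = set_power \<U> (supp_subgroup G p \<union> F) m)"

end

theory Submission
  imports Defs
begin

text \<open>
  After intersecting each \<open>W n\<close> with its set of inverses, a diagonal argument using (A) gives
  an index \<open>k\<close> such that every \<open>h\<close> in \<open>G(p\<^sub>k)\<close> agrees on the range of \<open>p\<^sub>k\<close> with some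
  \<open>w\<close> in \<open>W k\<close> commuting with \<open>p\<^sub>k\<close>: otherwise the direct sum of counterexamples would lie in no
  \<open>W k\<close>. Such \<open>w\<close> and \<open>h\<close> conjugate each \<open>g\<close> in \<open>G(p\<^sub>k)\<close> to the same element, so for large
  \<open>j\<close> both conjugacy classes in (B) lie in \<open>(W j)^3\<close>. Hence \<open>G(q)\<close> lies in \<open>(W j)^(3n)\<close>, and (C)
  gives \<open>G = (W j)^(3nm)\<close>.
\<close>

subsection \<open>Complex inner products\<close>

lemma cinner_add_right: "cinner x (y + z :: 'a::complex_inner) = cinner x y + cinner x z"
  by (metis cinner_add_left cinner_commute complex_cnj_add)

lemma cinner_scaleC_right: "cinner x (c *\<^sub>C y :: 'a::complex_inner) = cnj c * cinner x y"
  by (metis cinner_scaleC_left cinner_commute complex_cnj_mult)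

lemma cinner_zero_left [simp]: "cinner (0 :: 'a::complex_inner) y = 0"
  using cinner_add_left[of 0 0 y] by simp

lemma cinner_zero_right [simp]: "cinner y (0 :: 'a::complex_inner) = 0"
  using cinner_add_right[of y 0 0] by simp

lemma cinner_minus_left: "cinner (- x :: 'a::complex_inner) y = - cinner x y"
  using cinner_add_left[of x "- x" y] by (simp add: add_eq_0_iff)

lemma cinner_minus_right: "cinner y (- x :: 'a::complex_inner) = - cinner y x"
  using cinner_add_right[of y x "- x"] by (simp add: add_eq_0_iff)

lemma cinner_diff_left: "cinner (x - y :: 'a::complex_inner) z = cinner x z - cinner y z"
  using cinner_add_left[of x "- y" z] by (simp add: cinner_minus_left)

lemma cinner_diff_right: "cinner z (x - y :: 'a::complex_inner) = cinner z x - cinner z y"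
  using cinner_add_right[of z x "- y"] by (simp add: cinner_minus_right)

lemma cinner_eq_zero_iff: "cinner x x = 0 \<longleftrightarrow> (x :: 'a::complex_inner) = 0"
  by (simp add: norm_cinner)

lemma cinner_left_ext:
  assumes "\<And>z. cinner x z = cinner y z"
  shows "x = (y :: 'a::complex_inner)"
  using assms[of "x - y"] cinner_eq_zero_iff[of "x - y"] by (simp add: cinner_diff_left)

lemma norm_add_sq:
  "(norm (x + y :: 'a::complex_inner))\<^sup>2 = (norm x)\<^sup>2 + (norm y)\<^sup>2 + 2 * Re (cinner x y)"
proof -
  have "complex_of_real ((norm (x + y))\<^sup>2) =
      of_real ((norm x)\<^sup>2) + of_real ((norm y)\<^sup>2) + (cinner x y + cnj (cinner x y))"
    unfolding norm_cinner[symmetric]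
    by (simp add: cinner_add_left cinner_add_right cinner_commute[of y x])
  then show ?thesis
    by (simp add: complex_eq_iff)
qed

lemma parallelogram_law:
  "(norm (x + y :: 'a::complex_inner))\<^sup>2 + (norm (x - y))\<^sup>2 = 2 * (norm x)\<^sup>2 + 2 * (norm y)\<^sup>2"
  using norm_add_sq[of x y] norm_add_sq[of x "- y"] by (simp add: cinner_minus_right)

subsection \<open>Orthogonal projections\<close>

definition csubspace :: "'a::complex_inner set \<Rightarrow> bool" where
  "csubspace M \<longleftrightarrow> 0 \<in> M \<and> (\<forall>x\<in>M. \<forall>y\<in>M. x + y \<in> M) \<and> (\<forall>c. \<forall>x\<in>M. c *\<^sub>C x \<in> M)"

lemma csubspace_diff:
  assumes "csubspace M" "x \<in> M" "y \<in> M"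
  shows "x - y \<in> M"
proof -
  have "(- 1) *\<^sub>C y = - y"
    using scaleR_scaleC[of "- 1" y] by simp
  then show ?thesis
    using assms unfolding csubspace_def by (metis add_uminus_conv_diff)
qed

lemma csubspace_scaleR:
  "csubspace M \<Longrightarrow> x \<in> M \<Longrightarrow> r *\<^sub>R x \<in> M"
  by (simp add: csubspace_def scaleR_scaleC)

text \<open>Moving \<open>m\<close> by the optimal multiple \<open>c\<close> of \<open>z\<close>
  would lower the squared distance to \<open>x\<close> by \<open>(cmod a)\<^sup>2 / N\<close>, which
  is positive unless the inner product vanishes.\<close>

lemma nearest_point_orthogonal:
  assumes M: "csubspace M" and m: "m \<in> M"
    and min: "\<And>z. z \<in> M \<Longrightarrow> norm (x - m) \<le> norm (x - z :: 'a::complex_inner)"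
    and z: "z \<in> M"
  shows "cinner (x - m) z = 0"
proof (rule ccontr)
  assume nz: "cinner (x - m) z \<noteq> 0"
  define y where "y = x - m"
  define a where "a = cinner y z"
  define N where "N = (norm z)\<^sup>2"
  define c where "c = a / of_real N"
  have "z \<noteq> 0" using nz by auto
  then have N: "N > 0" by (simp add: N_def)
  have "m + c *\<^sub>C z \<in> M"
    using M m z by (simp add: csubspace_def)
  from min[OF this] have "(norm y)\<^sup>2 \<le> (norm (y - c *\<^sub>C z))\<^sup>2"
    by (simp add: y_def diff_diff_eq)
  moreover have "complex_of_real ((norm (y - c *\<^sub>C z))\<^sup>2)
      = of_real ((norm y)\<^sup>2) - (cnj c * a + c * cnj a - c * cnj c * of_real N)"
    unfolding norm_cinner[symmetric] a_def N_def
    by (simp add: cinner_diff_left cinner_diff_right cinner_scaleC_left cinner_scaleC_right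
        cinner_commute[of z y] algebra_simps)
  moreover have "cnj c * a + c * cnj a - c * cnj c * of_real N = of_real ((cmod a)\<^sup>2 / N)"
    using N complex_norm_square[of a] by (simp add: c_def field_simps)
  ultimately have "(norm y)\<^sup>2 \<le> (norm y)\<^sup>2 - (cmod a)\<^sup>2 / N"
    by (metis of_real_diff of_real_eq_iff)
  moreover have "(cmod a)\<^sup>2 / N > 0"
    using N nz by (simp add: a_def y_def)
  ultimately show False by simp
qed

text \<open>A minimising sequence is Cauchy by the parallelogram law; completeness supplies its
  limit and closedness keeps that limit in \<open>M\<close>.\<close>

lemma nearest_point_exists:
  assumes M: "csubspace M" and cl: "closed M"
  shows "\<exists>m\<in>M. \<forall>z\<in>M. norm (x - m) \<le> norm (x - z :: 'a::chilbert_space)"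
proof -
  define S where "S = (\<lambda>z. (norm (x - z))\<^sup>2) ` M"
  define d where "d = Inf S"
  have ne: "S \<noteq> {}" and bdd: "bdd_below S"
    using M by (auto simp: S_def csubspace_def intro!: bdd_belowI[of _ 0])
  have d: "d \<le> (norm (x - z))\<^sup>2" if "z \<in> M" for z
    unfolding d_def using bdd that by (intro cInf_lower) (auto simp: S_def)
  have "\<exists>z\<in>M. (norm (x - z))\<^sup>2 < d + 1 / real (Suc n)" for n
    using cInf_lessD[OF ne, of "d + 1 / real (Suc n)"] by (auto simp: d_def S_def)
  then obtain m where m: "\<And>n. m n \<in> M" "\<And>n. (norm (x - m n))\<^sup>2 < d + 1 / real (Suc n)"
    by metis
  \<comment> \<open>The midpoint of \<open>m i\<close> and \<open>m j\<close> stays in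
    \<open>M\<close>, so the sum of the residuals \<open>x - m i\<close> and \<open>x - m j\<close>
    has squared norm at least \<open>4 * d\<close>. The parallelogram law then leaves only the two
    errors for their difference.\<close>
  have close: "(norm (m i - m j))\<^sup>2 \<le> 2 / real (Suc i) + 2 / real (Suc j)" for i j
  proof -
    have "(1/2) *\<^sub>R (m i + m j) \<in> M"
      using M m by (intro csubspace_scaleR) (auto simp: csubspace_def)
    from d[OF this] have "4 * d \<le> (norm (2 *\<^sub>R (x - (1/2) *\<^sub>R (m i + m j))))\<^sup>2"
      by (simp add: power_mult_distrib)
    also have "2 *\<^sub>R (x - (1/2) *\<^sub>R (m i + m j)) = (x - m i) + (x - m j)"
      by (simp add: scaleR_diff_right scaleR_2)
    finally show ?thesis
      using parallelogram_law[of "x - m i" "x - m j"] m(2)[of i] m(2)[of j]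
      by (simp add: norm_minus_commute)
  qed
  have "Cauchy m"
  proof (rule metric_CauchyI)
    fix e :: real assume "e > 0"
    then obtain N where N: "1 / real (Suc N) < e\<^sup>2 / 4"
      by (metis divide_pos_pos nat_approx_posE zero_less_numeral zero_less_power)
    have "dist (m i) (m j) < e" if "i \<ge> N" "j \<ge> N" for i j
    proof -
      have "1 / real (Suc i) \<le> 1 / real (Suc N)" "1 / real (Suc j) \<le> 1 / real (Suc N)"
        using that by (auto intro!: divide_left_mono)
      then have "(norm (m i - m j))\<^sup>2 < e\<^sup>2"
        using close[of i j] N by simp
      then show ?thesis
        using \<open>e > 0\<close> by (simp add: dist_norm power2_less_imp_less)
    qed
    then show "\<exists>M. \<forall>i\<ge>M. \<forall>j\<ge>M. dist (m i) (m j) < e" by blast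
  qed
  then obtain l where l: "m \<longlonglongrightarrow> l"
    using Cauchy_convergent[of m] by (auto simp: convergent_def)
  have "l \<in> M"
    using closed_sequentially[OF cl m(1) l] .
  have lim: "(\<lambda>n. (norm (x - m n))\<^sup>2) \<longlonglongrightarrow> (norm (x - l))\<^sup>2"
    by (rule tendsto_power[OF tendsto_norm[OF tendsto_diff[OF tendsto_const l]]])
  have lim': "(\<lambda>n. d + 1 / real (Suc n)) \<longlonglongrightarrow> d + 0"
    by (rule tendsto_add[OF tendsto_const LIMSEQ_Suc[OF lim_1_over_n]])
  have "(norm (x - l))\<^sup>2 \<le> d + 0"
    by (rule LIMSEQ_le[OF lim lim']) (use less_imp_le[OF m(2)] in blast)
  then have "norm (x - l) \<le> norm (x - z)" if "z \<in> M" for z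
    using d[OF that] by (simp add: power2_le_imp_le)
  then show ?thesis using \<open>l \<in> M\<close> by blast
qed

text \<open>The projection sends \<open>x\<close> to its nearest point in \<open>M\<close>; its
  algebraic properties come from the orthogonality of \<open>x - p x\<close> to
  \<open>M\<close>.\<close>

lemma projection_exists:
  assumes M: "csubspace M" and cl: "closed (M :: 'a::chilbert_space set)"
  shows "\<exists>p. is_projection p \<and> range p = M"
proof -
  have "\<forall>x. \<exists>m. m \<in> M \<and> (\<forall>z\<in>M. cinner (x - m) z = 0)"
    using nearest_point_exists[OF M cl] nearest_point_orthogonal[OF M] by meson
  then obtain p where pM: "\<And>x. p x \<in> M" and orth: "\<And>x z. z \<in> M \<Longrightarrow> cinner (x - p x) z = 0"
    by metis
  \<comment> \<open>Two candidates differ by a vector of \<open>M\<close> orthogonal to itself.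
    Additivity, homogeneity and the values on \<open>M\<close> are read off from this
    uniqueness.\<close>
  have uniq: "p x = m" if m: "m \<in> M" "\<And>z. z \<in> M \<Longrightarrow> cinner (x - m) z = 0" for x m
  proof -
    have "p x - m \<in> M" using csubspace_diff[OF M pM m(1)] .
    from orth[OF this, of x] m(2)[OF this] have "cinner (p x - m) (p x - m) = 0"
      by (simp add: cinner_diff_left)
    then show ?thesis by (simp add: cinner_eq_zero_iff)
  qed
  have orth': "cinner z (x - p x) = 0" if "z \<in> M" for x z
    using orth[OF that, of x] cinner_commute[of z "x - p x"] by simp
  have add: "p (x + y) = p x + p y" for x y
  proof (rule uniq)
    show "p x + p y \<in> M" using M pM by (simp add: csubspace_def)
    show "cinner (x + y - (p x + p y)) z = 0" if "z \<in> M" for z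
      using orth[OF that, of x] orth[OF that, of y]
      by (simp add: cinner_diff_left cinner_add_left)
  qed
  have scale: "p (c *\<^sub>C x) = c *\<^sub>C p x" for c x
  proof (rule uniq)
    show "c *\<^sub>C p x \<in> M" using M pM by (simp add: csubspace_def)
    show "cinner (c *\<^sub>C x - c *\<^sub>C p x) z = 0" if "z \<in> M" for z
      using orth[OF that, of x] by (simp add: cinner_diff_left cinner_scaleC_left)
  qed
  have bound: "norm (p x) \<le> norm x" for x
  proof -
    have "(norm x)\<^sup>2 = (norm (p x))\<^sup>2 + (norm (x - p x))\<^sup>2"
      using norm_add_sq[of "p x" "x - p x"] orth'[OF pM, of x x] by simp
    then have "(norm (p x))\<^sup>2 \<le> (norm x)\<^sup>2" by simp
    then show ?thesis by (rule power2_le_imp_le) simp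
  qed
  have "bounded_linear p"
  proof (rule bounded_linear_intro)
    show "p (r *\<^sub>R x) = r *\<^sub>R p x" for r x by (simp add: scaleR_scaleC scale)
    show "norm (p x) \<le> norm x * 1" for x using bound by simp
  qed (rule add)
  moreover have fixed: "p x = x" if "x \<in> M" for x
    by (rule uniq) (simp_all add: that)
  then have "p \<circ> p = p" using pM by (simp add: fun_eq_iff)
  moreover have "is_cadjoint p p"
    unfolding is_cadjoint_def
  proof (intro allI)
    fix x y
    have "cinner x (p y) = cinner (p x) (p y)"
      using orth[OF pM, of x y] by (simp add: cinner_diff_left)
    moreover have "cinner (p x) y = cinner (p x) (p y)"
      using orth'[OF pM, of x y] by (simp add: cinner_diff_right)
    ultimately show "cinner (p x) y = cinner x (p y)" by simp
  qed
  ultimately have "is_projection p"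
    using scale by (simp add: is_projection_def BH_def)
  moreover have "range p = M"
  proof
    show "range p \<subseteq> M" using pM by blast
    show "M \<subseteq> range p"
    proof
      fix x assume "x \<in> M"
      then have "x = p x" by (simp add: fixed)
      then show "x \<in> range p" by (rule range_eqI)
    qed
  qed
  ultimately show ?thesis by blast
qed

section \<open>Algebra of projections and their ranges\<close>

lemma projection_idem: "is_projection p \<Longrightarrow> p (p x) = p x"
  unfolding is_projection_def by (metis comp_apply)

lemma projection_bounded_linear: "is_projection p \<Longrightarrow> bounded_linear p"
  by (simp add: is_projection_def BH_def)

lemma projection_diff: "is_projection p \<Longrightarrow> p (x - y) = p x - p y"
  by (simp add: projection_bounded_linear bounded_linear.linear linear_diff)

lemma projection_adjoint: "is_projection p \<Longrightarrow> cinner (p x) y = cinner x (p y)"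
  by (simp add: is_projection_def is_cadjoint_def)

text \<open>The second identity is the adjoint of the first.\<close>

lemma projection_absorb:
  assumes p: "is_projection p" and q: "is_projection q" and sub: "range q \<subseteq> range p"
  shows "p (q x) = q x" and "q (p x) = q x"
proof -
  show pq: "p (q x) = q x" for x
  proof -
    obtain y where "q x = p y" using sub by blast
    then show ?thesis by (simp add: projection_idem[OF p])
  qed
  show "q (p x) = q x"
    by (rule cinner_left_ext) (simp add: projection_adjoint p q pq)
qed

text \<open>Absorption in the two directions identifies \<open>p \<circ> q\<close> with
  \<open>q\<close> and with \<open>p\<close>.\<close>

lemma projection_range_inject:
  assumes "is_projection p" "is_projection q" "range p = range q"
  shows "p = q"
  using assms projection_absorb(1)[of p q] projection_absorb(2)[of q p] by (metis ext order_refl)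

text \<open>Existence, together with uniqueness by range, justifies the definite description in
  \<open>proj_onto\<close>.\<close>

lemma proj_onto:
  assumes "csubspace M" "closed (M :: 'a::chilbert_space set)"
  shows "is_projection (proj_onto M)" "range (proj_onto M) = M"
proof -
  have "\<exists>!p. is_projection p \<and> range p = M"
    using projection_exists[OF assms] projection_range_inject by metis
  from theI'[OF this] show "is_projection (proj_onto M)" "range (proj_onto M) = M"
    by (auto simp: proj_onto_def)
qed

subsection \<open>Unitaries supported below a projection\<close>

lemma unitary_add: "unitary g \<Longrightarrow> g (x + y) = g x + g y"
  by (simp add: unitary_def BH_def bounded_linear.linear linear_add)

lemma unitary_cinner: "unitary g \<Longrightarrow> cinner (g x) (g y) = cinner x y"
  unfolding unitary_def is_cadjoint_def by (metis comp_apply id_apply)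

lemma fixed_points_subspace:
  assumes "g \<in> BH"
  shows "csubspace {\<xi>. g \<xi> = \<xi>}" and "closed {\<xi>. g \<xi> = \<xi>}"
proof -
  have bl: "bounded_linear g" using assms by (simp add: BH_def)
  show "csubspace {\<xi>. g \<xi> = \<xi>}"
    using assms linear_0[OF bounded_linear.linear[OF bl]] linear_add[OF bounded_linear.linear[OF bl]]
    by (auto simp: csubspace_def BH_def)
  show "closed {\<xi>. g \<xi> = \<xi>}"
    using linear_continuous_on[OF bl] by (intro closed_Collect_eq) (auto intro: continuous_on_id)
qed

text \<open>Since \<open>supp g\<close> absorbs \<open>p\<close> on the right, it vanishes on the
  kernel of \<open>p\<close>. As \<open>supp g\<close> is the complement of the projection onto the
  fixed points, such an \<open>x\<close> is fixed.\<close>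

lemma supp_fixes_kernel:
  fixes g p :: "'a::chilbert_space \<Rightarrow> 'a"
  assumes g: "unitary g" and supp: "supp g \<le>\<^sub>p p" and x: "p x = 0"
  shows "g x = x"
proof -
  define E where "E = proj_onto {\<xi>. g \<xi> = \<xi>}"
  have E: "range E = {\<xi>. g \<xi> = \<xi>}"
    unfolding E_def using g by (intro proj_onto fixed_points_subspace) (simp_all add: unitary_def)
  have "is_projection p" "is_projection (supp g)" "range (supp g) \<subseteq> range p"
    using supp by (auto simp: subprojection_def)
  then have "supp g x = supp g 0"
    using projection_absorb(2)[of p "supp g" x] x by simp
  also have "\<dots> = 0"
    using \<open>is_projection (supp g)\<close> by (metis diff_self projection_diff)
  finally have "x = E x"
    by (simp add: supp_def E_def)
  then show ?thesis using E by (metis (mono_tags, lifting) mem_Collect_eq rangeI)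
qed

text \<open>A unitary fixing the kernel of \<open>p\<close> pointwise also preserves its orthogonal
  complement, the range of \<open>p\<close>; preserving both summands means commuting with
  \<open>p\<close>.\<close>

lemma supp_commutes:
  fixes g p :: "'a::chilbert_space \<Rightarrow> 'a"
  assumes g: "unitary g" and supp: "supp g \<le>\<^sub>p p"
  shows "g (p x) = p (g x)"
proof -
  have p: "is_projection p" using supp by (auto simp: subprojection_def)
  have ker: "p (z - p z) = 0" for z
    by (simp add: projection_diff projection_idem p)
  have fix_ker: "g (z - p z) = z - p z" for z
    using supp_fixes_kernel[OF g supp] ker by blast
  \<comment> \<open>Invariance of the range: the vectors \<open>z - p z\<close> run over the kernel,
    and \<open>g (p x)\<close> is orthogonal to all of them.\<close>
  have "p (g (p x)) = g (p x)"
  proof (rule cinner_left_ext)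
    fix z
    have "cinner (g (p x)) (z - p z) = cinner (p x) (z - p z)"
      using unitary_cinner[OF g, of "p x" "z - p z"] by (simp add: fix_ker)
    also have "\<dots> = 0"
      by (simp add: projection_adjoint p ker)
    finally show "cinner (p (g (p x))) z = cinner (g (p x)) z"
      by (simp add: projection_adjoint p cinner_diff_right)
  qed
  moreover have "g x = g (p x) + (x - p x)"
    using unitary_add[OF g, of "p x" "x - p x"] by (simp add: fix_ker)
  then have "p (g x) = p (g (p x))"
    using ker[of x] linear_add[OF bounded_linear.linear[OF projection_bounded_linear[OF p]]] by simp
  ultimately show ?thesis by simp
qed

section \<open>Conjugation in the unitary group\<close>

lemma unitary_group_simps [simp]:
  "carrier \<U> = {u. unitary u}" "u \<otimes>\<^bsub>\<U>\<^esub> v = u \<circ> v" "\<one>\<^bsub>\<U>\<^esub> = id"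
  by (simp_all add: unitary_group_def)

lemma unitary_inv:
  assumes "unitary u"
  shows "unitary (inv\<^bsub>\<U>\<^esub> u)" "inv\<^bsub>\<U>\<^esub> u \<circ> u = id" "u \<circ> inv\<^bsub>\<U>\<^esub> u = id"
  using group.inv_closed[OF group_unitary_group, of u] group.l_inv[OF group_unitary_group, of u]
    group.r_inv[OF group_unitary_group, of u] assms by auto

lemma conj_eq_of_agree:
  fixes g h w p :: "'a::chilbert_space \<Rightarrow> 'a"
  assumes g: "unitary g" "supp g \<le>\<^sub>p p" and h: "unitary h" "supp h \<le>\<^sub>p p"
    and w: "unitary w" "\<And>x. w (p x) = p (w x)" and agree: "\<And>x. w (p x) = h (p x)"
  shows "h \<circ> g \<circ> inv\<^bsub>\<U>\<^esub> h = w \<circ> g \<circ> inv\<^bsub>\<U>\<^esub> w"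
proof -
  txt \<open>\<open>h\<inverse> w\<close> is the identity on the range of \<open>p\<close> and commutes with \<open>p\<close>, hence commutes with \<open>g\<close>.\<close>
  define k where "k = inv\<^bsub>\<U>\<^esub> h"
  have k: "unitary k" "\<And>x. k (h x) = x" "\<And>x. h (k x) = x"
    using unitary_inv[OF h(1)] by (auto simp: k_def fun_eq_iff)
  have p: "is_projection p" using g by (auto simp: subprojection_def)
  have ker: "p (z - p z) = 0" for z
    by (simp add: projection_diff projection_idem p)
  have split: "f x = f (p x) + f (x - p x)" if "unitary f" for f :: "'a \<Rightarrow> 'a" and x
    using unitary_add[OF that, of "p x" "x - p x"] by simp
  have "k (w (g x)) = g (k (w x))" for x
  proof -
    have pg: "g (p x) = p (g x)" for x
      using supp_commutes[OF g] .
    have kp: "k (p x) = p (k x)" for x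
      by (metis k(2,3) supp_commutes[OF h])
    \<comment> \<open>The two components of \<open>x\<close> are treated separately: on the range of
      \<open>p\<close>, \<open>k\<close> undoes \<open>w\<close> because \<open>w\<close> agrees
      with \<open>h\<close> there; on the kernel, \<open>g\<close> is the identity.\<close>
    have "k (w (g x)) = k (w (g (p x))) + k (w (g (x - p x)))"
      using split[OF g(1)] unitary_add[OF w(1)] unitary_add[OF k(1)] by metis
    also have "k (w (g (p x))) = g (p x)"
      by (simp add: pg agree k)
    also have "k (w (g (x - p x))) = k (w (x - p x))"
      using supp_fixes_kernel[OF g] ker by simp
    also have "g (p x) = g (k (w (p x)))"
      by (simp add: agree k)
    also have "k (w (x - p x)) = g (k (w (x - p x)))"
    proof -
      \<comment> \<open>Both \<open>k\<close> and \<open>w\<close> commute with \<open>p\<close>, so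
        they keep the vector in the kernel, where \<open>g\<close> acts trivially.\<close>
      have "p (k (w (x - p x))) = k (w (p (x - p x)))"
        by (simp add: kp w(2))
      also have "\<dots> = k (w 0)" by (simp add: ker)
      also have "\<dots> = 0"
        using unitary_add[OF w(1), of 0 0] unitary_add[OF k(1), of 0 0] by simp
      finally show ?thesis using supp_fixes_kernel[OF g] by simp
    qed
    also have "g (k (w (p x))) + g (k (w (x - p x))) = g (k (w x))"
      using split[OF w(1), of x] unitary_add[OF g(1)] unitary_add[OF k(1)] by metis
    finally show ?thesis .
  qed
  \<comment> \<open>Applying \<open>h\<close> cancels \<open>k\<close> on the left; evaluating at
    the inverse image of a vector under \<open>w\<close> then gives the claim.\<close>
  then have "w (g x) = h (g (k (w x)))" for x
    by (metis k(3))
  moreover have "w ((inv\<^bsub>\<U>\<^esub> w) x) = x" for x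
    using unitary_inv(3)[OF w(1)] by (metis comp_apply id_apply)
  ultimately show ?thesis
    by (simp add: fun_eq_iff k_def[symmetric])
qed

subsection \<open>Powers of subsets and exhausting chains\<close>

text \<open>Powers depend only on multiplication and unit, so they may be computed in \<U> and read
  back in the subgroup.\<close>

lemma set_power_carrier [simp]: "set_power (K\<lparr>carrier := H\<rparr>) W k = set_power K W k"
  by (simp add: set_power_def)

lemma set_power_0: "set_power K W 0 = {\<one>\<^bsub>K\<^esub>}"
  by (auto simp: set_power_def)

lemma set_power_Suc:
  "set_power K W (Suc k) = {w \<otimes>\<^bsub>K\<^esub> y | w y. w \<in> W \<and> y \<in> set_power K W k}"
proof safe
  fix x assume "x \<in> set_power K W (Suc k)"
  then obtain w ws where "x = foldr (\<otimes>\<^bsub>K\<^esub>) (w # ws) \<one>\<^bsub>K\<^esub>" "length ws = k" "set (w # ws) \<subseteq> W"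
    by (auto simp: set_power_def length_Suc_conv)
  then show "\<exists>w y. x = w \<otimes>\<^bsub>K\<^esub> y \<and> w \<in> W \<and> y \<in> set_power K W k"
    by (auto simp: set_power_def)
next
  fix w y assume "w \<in> W" "y \<in> set_power K W k"
  then obtain ws where "y = foldr (\<otimes>\<^bsub>K\<^esub>) ws \<one>\<^bsub>K\<^esub>" "length (w # ws) = Suc k" "set (w # ws) \<subseteq> W"
    by (auto simp: set_power_def)
  then show "w \<otimes>\<^bsub>K\<^esub> y \<in> set_power K W (Suc k)"
    unfolding set_power_def by (intro CollectI exI[of _ "w # ws"]) auto
qed

lemma set_power_mono: "V \<subseteq> W \<Longrightarrow> set_power K V k \<subseteq> set_power K W k"
  by (auto simp: set_power_def)

context monoid
begin

lemma set_power_closed: "W \<subseteq> carrier G \<Longrightarrow> set_power G W k \<subseteq> carrier G"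
  by (induction k) (auto simp: set_power_0 set_power_Suc)

lemma set_power_add:
  assumes W: "W \<subseteq> carrier G" and x: "x \<in> set_power G W a" and y: "y \<in> set_power G W b"
  shows "x \<otimes> y \<in> set_power G W (a + b)"
  using x
proof (induction a arbitrary: x)
  case 0
  then show ?case using y set_power_closed[OF W, of b] by (auto simp: set_power_0)
next
  case (Suc a)
  then obtain w z where wz: "x = w \<otimes> z" "w \<in> W" "z \<in> set_power G W a"
    by (auto simp: set_power_Suc)
  then have "x \<otimes> y = w \<otimes> (z \<otimes> y)"
    using W y set_power_closed[OF W, of a] set_power_closed[OF W, of b] by (auto intro!: m_assoc)
  then show ?case using Suc.IH[OF wz(3)] wz(2) by (auto simp: set_power_Suc)
qed

text \<open>Substituting a word of length \<open>a\<close> for each of \<open>b\<close> letters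
  multiplies the lengths. This combines the exponents of (B) and (C).\<close>

lemma set_power_mult:
  assumes W: "W \<subseteq> carrier G" and V: "V \<subseteq> set_power G W a"
  shows "set_power G V b \<subseteq> set_power G W (a * b)"
proof (induction b)
  case 0
  then show ?case by (simp add: set_power_0)
next
  case (Suc b)
  then show ?case using V set_power_add[OF W, of _ a _ "a * b"] by (auto simp: set_power_Suc)
qed

text \<open>Shorter words are padded with the unit.\<close>

lemma set_power_le:
  assumes W: "W \<subseteq> carrier G" and one: "\<one> \<in> W" and le: "a \<le> b"
  shows "set_power G W a \<subseteq> set_power G W b"
proof -
  have "set_power G W a \<subseteq> set_power G W (a + d)" for d
  proof (induction d)
    case (Suc d)
    have "set_power G W k \<subseteq> set_power G W (Suc k)" for k
    proof
      fix x assume x: "x \<in> set_power G W k"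
      then have "x = \<one> \<otimes> x" using set_power_closed[OF W, of k] by auto
      with x one show "x \<in> set_power G W (Suc k)" unfolding set_power_Suc by blast
    qed
    with Suc show ?case by auto
  qed simp
  then show ?thesis using le by (metis le_add_diff_inverse)
qed

lemma subset_set_power:
  assumes W: "W \<subseteq> carrier G" and one: "\<one> \<in> W" and k: "k \<ge> 1"
  shows "W \<subseteq> set_power G W k"
proof -
  have "W \<subseteq> set_power G W 1"
    using W by (force simp: set_power_Suc set_power_0)
  then show ?thesis using set_power_le[OF W one k] by blast
qed

end

section \<open>Exhausting chains\<close>

lemma exhausting_chain_mono: "exhausting_chain K W \<Longrightarrow> i \<le> j \<Longrightarrow> W i \<subseteq> W j"
  by (simp add: exhausting_chain_def incseqD)

text \<open>The lower bound \<open>i\<close> allows a stage to be chosen beyond one that is already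
  fixed.\<close>

lemma exhausting_chain_finite:
  assumes W: "exhausting_chain K W" and "finite F" "F \<subseteq> carrier K"
  shows "\<exists>j\<ge>i. F \<subseteq> W j"
  using assms(2,3)
proof (induction F rule: finite_induct)
  case (insert x F)
  then obtain j where j: "j \<ge> i" "F \<subseteq> W j" by auto
  obtain l where "x \<in> W l" using insert.prems W by (auto simp: exhausting_chain_def)
  then have "insert x F \<subseteq> W (max j l)"
    using j exhausting_chain_mono[OF W, of j "max j l"] exhausting_chain_mono[OF W, of l "max j l"] by auto
  then show ?case using j(1) by (metis max.coboundedI1)
qed auto

text \<open>An element and its inverse eventually share a stage. Symmetric stages are wanted because
  a conjugate contains both \<open>w\<close> and its inverse.\<close>

lemma (in group) exhausting_chain_symmetric:
  assumes W: "exhausting_chain G W"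
  shows "exhausting_chain G (\<lambda>n. {g \<in> W n. inv g \<in> W n})"
  unfolding exhausting_chain_def
proof
  show "incseq (\<lambda>n. {g \<in> W n. inv g \<in> W n})"
    using exhausting_chain_mono[OF W] by (auto simp: incseq_def)
  have "\<exists>n. g \<in> W n \<and> inv g \<in> W n" if "g \<in> carrier G" for g
    using exhausting_chain_finite[OF W, of "{g, inv g}" 0] that by auto
  then show "(\<Union>n. {g \<in> W n. inv g \<in> W n}) = carrier G"
    using W by (auto simp: exhausting_chain_def)
qed

subsection \<open>Cofinality\<close>

text \<open>By orthogonality a single term of the series survives, whether \<open>p k\<close> is
  applied to the argument or, using its continuity, to the sum.\<close>

lemma sums_comp_projection:
  assumes p: "\<And>n. is_projection (p n)" and orth: "\<And>i j. i \<noteq> j \<Longrightarrow> p i \<circ> p j = zero_op"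
    and g: "\<And>n. unitary (g n)" "\<And>n. g n \<circ> p n = p n \<circ> g n"
    and u: "sot_sums (\<lambda>n. g n \<circ> p n) u"
  shows "u (p k x) = g k (p k x)" and "p k (u x) = g k (p k x)"
proof -
  have g0: "g n 0 = 0" for n using unitary_add[OF g(1), of n 0 0] by simp
  have pp: "p i (p j y) = (if i = j then p j y else 0)" for i j y
    using projection_idem[OF p] orth[of i j] by (auto simp: fun_eq_iff zero_op_def)
  have gp: "g n (p n y) = p n (g n y)" for n y
    using g(2) by (metis comp_apply)
  have single: "(\<lambda>n. if n = k then g k (p k x) else 0) sums g k (p k x)"
    by (rule sums_single)
  have "(g n \<circ> p n) (p k x) = (if n = k then g k (p k x) else 0)" for n
    by (simp add: pp g0)
  moreover have "(\<lambda>n. (g n \<circ> p n) (p k x)) sums u (p k x)"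
    using u unfolding sot_sums_def by blast
  ultimately have "(\<lambda>n. if n = k then g k (p k x) else 0) sums u (p k x)"
    by presburger
  then show "u (p k x) = g k (p k x)"
    using sums_unique2 single by blast
  have "p k ((g n \<circ> p n) x) = (if n = k then g k (p k x) else 0)" for n
    by (simp add: pp gp)
  moreover have "(\<lambda>n. p k ((g n \<circ> p n) x)) sums p k (u x)"
    using bounded_linear.sums[OF projection_bounded_linear[OF p]] u unfolding sot_sums_def by blast
  ultimately have "(\<lambda>n. if n = k then g k (p k x) else 0) sums p k (u x)"
    by presburger
  then show "p k (u x) = g k (p k x)"
    using sums_unique2 single by blast
qed

lemma diagonal_agreement:
  fixes G P :: "('a::chilbert_space \<Rightarrow> 'a) set"
  assumes G: "G \<subseteq> {u. unitary u}" and P: "\<forall>p\<in>P. is_projection p" and A: "condition_A G P"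
    and W: "exhausting_chain (\<U>\<lparr>carrier := G\<rparr>) W"
  shows "\<exists>p\<in>P. p \<noteq> zero_op \<and> (\<exists>k. \<forall>h\<in>supp_subgroup G p.
    \<exists>w\<in>W k. (\<forall>x. w (p x) = p (w x)) \<and> (\<forall>x. w (p x) = h (p x)))"
proof (rule ccontr)
  assume neg: "\<not> ?thesis"
  from A obtain p where p: "\<forall>n. p n \<in> P \<and> p n \<noteq> zero_op"
    and orth: "\<forall>i j. i \<noteq> j \<longrightarrow> p i \<circ> p j = zero_op"
    and sums: "\<forall>g. (\<forall>n. g n \<in> G \<and> g n \<circ> p n = p n \<circ> g n) \<longrightarrow> (\<exists>u\<in>G. sot_sums (\<lambda>n. g n \<circ> p n) u)"
    unfolding condition_A_def by blast
  \<comment> \<open>The diagonal choice: the same \<open>k\<close> indexes the projection and the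
    stage of the chain.\<close>
  define bad where "bad k h \<longleftrightarrow> h \<in> supp_subgroup G (p k) \<and>
      \<not> (\<exists>w\<in>W k. (\<forall>x. w (p k x) = p k (w x)) \<and> (\<forall>x. w (p k x) = h (p k x)))" for k h
  have "\<forall>k. \<exists>h. bad k h"
    using neg p unfolding bad_def by blast
  then obtain g where bad: "\<forall>k. bad k (g k)"
    using choice[of bad] by blast
  have g': "g k \<in> G" "unitary (g k)" "supp (g k) \<le>\<^sub>p p k" for k
    using bad G by (auto simp: bad_def supp_subgroup_def)
  \<comment> \<open>The commutation that (A) demands follows from the support condition.\<close>
  have comm: "g k \<circ> p k = p k \<circ> g k" for k
    using supp_commutes[OF g'(2,3)] by (simp add: fun_eq_iff)
  then obtain u where u: "u \<in> G" "sot_sums (\<lambda>n. g n \<circ> p n) u"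
    using sums g'(1) by blast
  have agree: "u (p k x) = g k (p k x)" "p k (u x) = g k (p k x)" for k x
    using sums_comp_projection[OF _ _ g'(2) comm u(2)] P p orth by auto
  \<comment> \<open>At this \<open>k\<close> the sum \<open>u\<close> is itself a witness for
    \<open>g k\<close>: it commutes with \<open>p k\<close> and agrees with \<open>g k\<close> on
    its range.\<close>
  obtain k where "u \<in> W k" using W u(1) by (auto simp: exhausting_chain_def)
  then show False
    using bad agree[of k] unfolding bad_def by metis
qed

text \<open>The sets \<open>N\<close> and \<open>M\<close> of admissible exponents serve both
  claims: \<open>UNIV\<close> gives mere existence, singletons give prescribed exponents.\<close>

lemma exists_power_exhausting:
  fixes G P :: "('a::chilbert_space \<Rightarrow> 'a) set"
  assumes G: "subgroup G \<U>" and P: "\<forall>p\<in>P. is_projection p" and A: "condition_A G P"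
    and B: "\<And>p. p \<in> P \<Longrightarrow> p \<noteq> zero_op \<Longrightarrow> \<exists>n\<in>N. n \<ge> 1 \<and> condition_B G P p n"
    and C: "\<And>p. p \<in> P \<Longrightarrow> p \<noteq> zero_op \<Longrightarrow> \<exists>m\<in>M. m \<ge> 1 \<and> condition_C G p m"
    and W: "exhausting_chain (\<U>\<lparr>carrier := G\<rparr>) W"
  shows "\<exists>n\<in>N. \<exists>m\<in>M. n \<ge> 1 \<and> m \<ge> 1 \<and> (\<exists>j. G = set_power \<U> (W j) (3 * n * m))"
proof -
  interpret U: group "\<U> :: ('a \<Rightarrow> 'a) monoid" by (rule group_unitary_group)
  interpret K: group "\<U>\<lparr>carrier := G\<rparr>" by (rule U.subgroup_imp_group[OF G])
  have GU: "G \<subseteq> {u. unitary u}" using subgroup.subset[OF G] by simp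
  define V where "V n = {g \<in> W n. inv\<^bsub>\<U>\<lparr>carrier := G\<rparr>\<^esub> g \<in> W n}" for n
  have V: "exhausting_chain (\<U>\<lparr>carrier := G\<rparr>) V"
    unfolding V_def by (rule K.exhausting_chain_symmetric[OF W])
  have VG: "V n \<subseteq> G" for n using V by (auto simp: exhausting_chain_def)
  \<comment> \<open>The inverse in \<open>V\<close> is taken in the subgroup; it is identified with
    the inverse in \<U>.\<close>
  have V_inv: "inv\<^bsub>\<U>\<^esub> g \<in> V n" if "g \<in> V n" for g n
  proof -
    have "g \<in> G" using that VG by auto
    then have "inv\<^bsub>\<U>\<lparr>carrier := G\<rparr>\<^esub> (inv\<^bsub>\<U>\<lparr>carrier := G\<rparr>\<^esub> g) = g"
      by (intro K.inv_inv) simp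
    then show ?thesis
      using that \<open>g \<in> G\<close> U.m_inv_consistent[OF G] by (simp add: V_def)
  qed
  obtain p k where p: "p \<in> P" "p \<noteq> zero_op"
    and agree: "\<And>h. h \<in> supp_subgroup G p \<Longrightarrow>
      \<exists>w\<in>V k. (\<forall>x. w (p x) = p (w x)) \<and> (\<forall>x. w (p x) = h (p x))"
    using diagonal_agreement[OF GU P A V] by blast
  obtain n where n: "n \<in> N" "n \<ge> 1" "condition_B G P p n" using B[OF p] by blast
  obtain q g where q: "q \<in> P" "q \<noteq> zero_op" and g: "g \<in> supp_subgroup G p"
    and sub: "supp_subgroup G q \<subseteq> set_power \<U> (conj_class \<U> (supp_subgroup G p) g \<union>
      conj_class \<U> (supp_subgroup G p) (inv\<^bsub>\<U>\<^esub> g)) n"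
    using n(3) unfolding condition_B_def by blast
  \<comment> \<open>(C) is applied to the smaller projection \<open>q\<close>, since it is
    \<open>G(q)\<close> that (B) bounds.\<close>
  obtain m F where m: "m \<in> M" "m \<ge> 1" and F: "finite F" "F \<subseteq> G"
    and GF: "G = set_power \<U> (supp_subgroup G q \<union> F) m"
    using C[OF q] unfolding condition_C_def by blast
  have "g \<in> G" using g by (simp add: supp_subgroup_def)
  have "id \<in> G" using subgroup.one_closed[OF G] by simp
  \<comment> \<open>Beyond \<open>k\<close> all the elements \<open>w\<close> remain available;
    including \<open>id\<close> permits padding of words.\<close>
  obtain j where j: "j \<ge> k" "F \<union> {g, id} \<subseteq> V j"
    using exhausting_chain_finite[OF V, of "F \<union> {g, id}" k] F \<open>g \<in> G\<close> \<open>id \<in> G\<close> by auto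
  have VU: "V j \<subseteq> carrier \<U>" and one: "\<one>\<^bsub>\<U>\<^esub> \<in> V j" using VG GU j by auto
  have mult: "a \<circ> b \<in> set_power \<U> (V j) (r + s)"
    if "a \<in> set_power \<U> (V j) r" "b \<in> set_power \<U> (V j) s" for a b r s
    using U.set_power_add[OF VU that] by simp
  have V1: "V j \<subseteq> set_power \<U> (V j) 1"
    using U.subset_set_power[OF VU one] by simp
  \<comment> \<open>Replacing \<open>h\<close> by \<open>w\<close> leaves three factors,
    \<open>w\<close>, the conjugated element and the inverse of \<open>w\<close>, all in
    \<open>V j\<close>.\<close>
  have conj: "h \<circ> g \<circ> inv\<^bsub>\<U>\<^esub> h \<in> set_power \<U> (V j) 3 \<and>
      h \<circ> inv\<^bsub>\<U>\<^esub> g \<circ> inv\<^bsub>\<U>\<^esub> h \<in> set_power \<U> (V j) 3" if h: "h \<in> supp_subgroup G p" for h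
  proof -
    obtain w where w: "w \<in> V k" "\<And>x. w (p x) = p (w x)" "\<And>x. w (p x) = h (p x)"
      using agree[OF h] by blast
    have wj: "w \<in> V j" using w(1) exhausting_chain_mono[OF V j(1)] by blast
    have un: "unitary w" "unitary g" "unitary h" using wj VG GU \<open>g \<in> G\<close> h by (auto simp: supp_subgroup_def)
    have "h \<circ> g \<circ> inv\<^bsub>\<U>\<^esub> h = w \<circ> g \<circ> inv\<^bsub>\<U>\<^esub> w"
      by (rule conj_eq_of_agree[of _ p]) (use g h w un in \<open>auto simp: supp_subgroup_def\<close>)
    \<comment> \<open>The class of the inverse of \<open>g\<close> is handled by inverting the
      identity already obtained for \<open>g\<close>.\<close>
    moreover have "f \<circ> inv\<^bsub>\<U>\<^esub> g \<circ> inv\<^bsub>\<U>\<^esub> f = inv\<^bsub>\<U>\<^esub> (f \<circ> g \<circ> inv\<^bsub>\<U>\<^esub> f)" if "unitary f" for f :: "'a \<Rightarrow> 'a"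
      using U.inv_mult_group[of "f \<circ> g" "inv\<^bsub>\<U>\<^esub> f"] U.inv_mult_group[of f g] U.inv_inv[of f]
        U.m_closed[of f g] that un(2) unitary_inv(1)[OF that] by (simp add: comp_assoc)
    ultimately have "h \<circ> inv\<^bsub>\<U>\<^esub> g \<circ> inv\<^bsub>\<U>\<^esub> h = w \<circ> inv\<^bsub>\<U>\<^esub> g \<circ> inv\<^bsub>\<U>\<^esub> w"
      using un by simp
    moreover have "w \<circ> f \<circ> inv\<^bsub>\<U>\<^esub> w \<in> set_power \<U> (V j) 3" if "f \<in> V j" for f
      using mult[of "w \<circ> f" 2 "inv\<^bsub>\<U>\<^esub> w" 1] mult[of w 1 f 1] that wj V_inv[OF wj] V1
      by (auto simp: numeral_2_eq_2 numeral_3_eq_3)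
    ultimately show ?thesis
      using \<open>h \<circ> g \<circ> inv\<^bsub>\<U>\<^esub> h = w \<circ> g \<circ> inv\<^bsub>\<U>\<^esub> w\<close> V_inv[of g j] j(2) by simp
  qed
  have "supp_subgroup G q \<subseteq> set_power \<U> (V j) (3 * n)"
    using conj by (intro order_trans[OF sub] U.set_power_mult[OF VU]) (auto simp: conj_class_def)
  \<comment> \<open>Single letters are padded to length \<open>3 * n\<close>, which is positive
    because \<open>n \<ge> 1\<close>.\<close>
  moreover have "F \<subseteq> set_power \<U> (V j) (3 * n)"
    using U.subset_set_power[OF VU one, of "3 * n"] n(2) j(2) by auto
  ultimately have "G \<subseteq> set_power \<U> (V j) (3 * n * m)"
    by (subst GF) (intro U.set_power_mult[OF VU], auto)
  \<comment> \<open>Each symmetric stage lies in the original one, so the bound passes back to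
    \<open>W\<close>.\<close>
  also have "\<dots> \<subseteq> set_power \<U> (W j) (3 * n * m)"
    by (rule set_power_mono) (auto simp: V_def)
  finally have "G \<subseteq> set_power \<U> (W j) (3 * n * m)" .
  moreover have "set_power \<U> (W j) (3 * n * m) \<subseteq> G"
    using K.set_power_closed[of "W j"] W by (auto simp: exhausting_chain_def)
  ultimately show ?thesis using n m by blast
qed

theorem theorem3p1:
  fixes G P :: "('a::chilbert_space \<Rightarrow> 'a) set"
  assumes "infinite_cdim TYPE('a)"
    and "subgroup G \<U>"
    and "infinite P" and "\<forall>p\<in>P. is_projection p"
    and "condition_A G P"
    and "\<forall>p\<in>P. p \<noteq> zero_op \<longrightarrow> (\<exists>n\<ge>1. condition_B G P p n)"
    and "\<forall>p\<in>P. p \<noteq> zero_op \<longrightarrow> (\<exists>m\<ge>1. condition_C G p m)"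
  shows "strong_uncountable_cofinality (\<U>\<lparr>carrier := G\<rparr>) \<and>
    (\<forall>n\<ge>1. \<forall>m\<ge>1.
      (\<forall>p\<in>P. p \<noteq> zero_op \<longrightarrow> condition_B G P p n) \<and>
      (\<forall>p\<in>P. p \<noteq> zero_op \<longrightarrow> condition_C G p m) \<longrightarrow>
      k_strong_uncountable_cofinality (3 * n * m) (\<U>\<lparr>carrier := G\<rparr>))"
proof (intro conjI allI impI)
  show "strong_uncountable_cofinality (\<U>\<lparr>carrier := G\<rparr>)"
    unfolding strong_uncountable_cofinality_def
  proof (intro allI impI)
    fix W assume "exhausting_chain (\<U>\<lparr>carrier := G\<rparr>) W"
    then obtain n m j :: nat where "n \<ge> 1" "m \<ge> 1" "G = set_power \<U> (W j) (3 * n * m)"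
      using exists_power_exhausting[OF assms(2,4,5), of UNIV UNIV W] assms(6,7) by auto
    then show "\<exists>k\<ge>1. \<exists>n. carrier (\<U>\<lparr>carrier := G\<rparr>) = set_power (\<U>\<lparr>carrier := G\<rparr>) (W n) k"
      by (intro exI[of _ "3 * n * m"] conjI exI[of _ j]) auto
  qed
next
  fix n m :: nat
  assume "1 \<le> n" "1 \<le> m" "(\<forall>p\<in>P. p \<noteq> zero_op \<longrightarrow> condition_B G P p n) \<and>
    (\<forall>p\<in>P. p \<noteq> zero_op \<longrightarrow> condition_C G p m)"
  then show "k_strong_uncountable_cofinality (3 * n * m) (\<U>\<lparr>carrier := G\<rparr>)"
    unfolding k_strong_uncountable_cofinality_def
    using exists_power_exhausting[OF assms(2,4,5), of "{n}" "{m}"] by simp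
qed

end
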